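(* Let $\alpha\in\mathbb{R}/\mathbb{Z}$ be irrational. The asymptotic bound $$\mathscr{B}_\alpha(r)\asymp\sqrt{r}\qquad\text{as } r\to\infty$$ holds if and only if $\alpha\in\mathscr{D}_2$.
   Context: Fix $\varepsilon$ with $0<\varepsilon\le\varepsilon_4$, where $\varepsilon_4>0$ is the Margulis constant of hyperbolic 4-space $\mathbb{H}^4$, and put $c(\varepsilon)=1/\sqrt{2\cosh(\varepsilon)-2}$. The boundary function $\mathscr{B}_\alpha:[0,\infty)\to\mathbb{R}$ is $$\mathscr{B}_\alpha(r)=\inf_{j\ge1}c(\varepsilon)\sqrt{4\sin^2(\pi j\alpha)\,r^2+j^2},$$ the infimum being over integers $j\ge1$. For positive functions $f(r),g(r)$ of $r>0$, the notation $f(r)\asymp g(r)$ means that there is a universal constant $C\ge1$ such that $C^{-1}g(r)\le f(r)\le C\,g(r)$ for all large $r$; here a universal constant is one which is independent of all the parameters and variables involved. $\mathscr{D}_2$ is the set of Diophantine numbers of exponent $2$ (numbers of bounded type), i.e. those $\alpha$ for which there is a constant $\kappa>0$ with $|\alpha-p/q|>\kappa/|q|^2$ for every rational number $p/q$; equivalently, the partial quotients in the continued fraction expansion of $\alpha$ are bounded.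
   Formalization: The constant C in ≍ and the threshold for "large r" may depend on α and ε; with a universal C the claim fails, e.g. for α=[0;a,a,a,…] in D_2 with a large, where B_α(r)/√r falls to order c(ε)/√a for arbitrarily large r. *)

theory Defs
  imports
    "HOL-Analysis.Analysis"
    "HOL-Algebra.Bij"
    "HOL-Algebra.Generated_Groups"
begin

section \<open>Hyperbolic 4-space and its Margulis constant\<close>

text \<open>Upper half-space model: a point is a pair \<open>(x, t)\<close> with \<open>x\<close> in Euclidean 3-space and
  \<open>t > 0\<close>. The norm on the product type is the Euclidean one.\<close>

definition hyp4 :: "((real^3) \<times> real) set" where
  "hyp4 = {p. snd p > 0}"

definition hyp_dist :: "(real^3) \<times> real \<Rightarrow> (real^3) \<times> real \<Rightarrow> real" where
  "hyp_dist p q = arcosh (1 + (dist p q)\<^sup>2 / (2 * snd p * snd q))"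

text \<open>Isometries are elements of the library's group of bijections of a set, so they are
  \<open>undefined\<close> outside of \<open>hyp4\<close>.\<close>

definition hyp_isometries :: "((real^3) \<times> real \<Rightarrow> (real^3) \<times> real) set" where
  "hyp_isometries =
     {g \<in> Bij hyp4. \<forall>p\<in>hyp4. \<forall>q\<in>hyp4. hyp_dist (g p) (g q) = hyp_dist p q}"

text \<open>The topology on the isometry group is that of pointwise convergence, which agrees with
  the compact-open topology on isometries. The hyperbolic metric induces the Euclidean topology
  on \<open>hyp4\<close>, so the product topology of the Euclidean topology can be used.\<close>

definition discrete_isometry_group :: "((real^3) \<times> real \<Rightarrow> (real^3) \<times> real) set \<Rightarrow> bool" where
  "discrete_isometry_group \<Gamma> \<longleftrightarrow>
     subgroup \<Gamma> (BijGroup hyp4) \<and> \<Gamma> \<subseteq> hyp_isometries \<and>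
     subtopology (product_topology (\<lambda>_. euclidean) hyp4) \<Gamma> = discrete_topology \<Gamma>"

definition virtually_abelian :: "('a, 'b) monoid_scheme \<Rightarrow> bool" where
  "virtually_abelian G \<longleftrightarrow>
     (\<exists>A. subgroup A G \<and> comm_group (G\<lparr>carrier := A\<rparr>) \<and> finite (rcosets\<^bsub>G\<^esub> A))"

text \<open>For discrete groups of isometries of hyperbolic space, virtually abelian, virtually
  nilpotent and elementary are the same. The Margulis lemma says that the set below contains
  a positive number; it is closed under passing to smaller positive numbers.\<close>

definition margulis_numbers :: "real set" where
  "margulis_numbers =
     {\<epsilon>. 0 < \<epsilon> \<and>
        (\<forall>\<Gamma>. discrete_isometry_group \<Gamma> \<longrightarrow>
          (\<forall>p\<in>hyp4.
            virtually_abelian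
              ((BijGroup hyp4)\<lparr>carrier :=
                 generate (BijGroup hyp4) {g \<in> \<Gamma>. hyp_dist p (g p) \<le> \<epsilon>}\<rparr>)))}"

definition margulis_constant :: real where
  "margulis_constant = Sup margulis_numbers"


section \<open>The boundary function\<close>

definition cusp_coeff :: "real \<Rightarrow> real" where
  "cusp_coeff \<epsilon> = 1 / sqrt (2 * cosh \<epsilon> - 2)"

definition boundary_fun :: "real \<Rightarrow> real \<Rightarrow> real \<Rightarrow> real" where
  "boundary_fun \<epsilon> \<alpha> r =
     (INF j\<in>{1::nat..}.
        cusp_coeff \<epsilon> * sqrt (4 * (sin (pi * real j * \<alpha>))\<^sup>2 * r\<^sup>2 + (real j)\<^sup>2))"

text \<open>The constant \<open>C\<close> does not depend on the variable \<open>r\<close>. If \<open>f\<close> and \<open>g\<close> depend on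
  parameters, \<open>C\<close> and the threshold for \<open>r\<close> may depend on them.\<close>

definition comparable_at_top :: "(real \<Rightarrow> real) \<Rightarrow> (real \<Rightarrow> real) \<Rightarrow> bool" where
  "comparable_at_top f g \<longleftrightarrow>
     (\<exists>C\<ge>1. \<forall>\<^sub>F r in at_top. inverse C * g r \<le> f r \<and> f r \<le> C * g r)"


section \<open>Diophantine numbers of exponent 2\<close>

definition diophantine2 :: "real set" where
  "diophantine2 =
     {\<alpha>. \<exists>\<kappa>>0. \<forall>p q :: int. q \<noteq> 0 \<longrightarrow>
        \<bar>\<alpha> - real_of_int p / real_of_int q\<bar> > \<kappa> / \<bar>real_of_int q\<bar>\<^sup>2}"

text \<open>Elements of \<open>\<real>/\<int>\<close> are given by real representatives. The following facts, together with
  the invariance of \<open>\<rat>\<close> under integer translations, show that the choice of representative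
  does not matter.\<close>

lemma boundary_fun_add_int: "boundary_fun \<epsilon> (\<alpha> + of_int m) r = boundary_fun \<epsilon> \<alpha> r"
proof -
  have "(sin (pi * real j * (\<alpha> + of_int m)))\<^sup>2 = (sin (pi * real j * \<alpha>))\<^sup>2" for j :: nat
  proof -
    have "cos (2 * (pi * real j * (\<alpha> + of_int m)))
        = cos (2 * (pi * real j * \<alpha>) + 2 * pi * of_int (int j * m))"
      by (simp add: algebra_simps)
    also have "\<dots> = cos (2 * (pi * real j * \<alpha>))"
      by (simp only: cos_add cos_int_2pin sin_int_2pin mult_1_right mult_zero_right diff_0_right)
    finally show ?thesis
      unfolding cos_double_sin by linarith
  qed
  then show ?thesis
    by (simp add: boundary_fun_def)
qed

lemma diophantine2_add_int:
  assumes "\<alpha> \<in> diophantine2"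
  shows "\<alpha> + of_int m \<in> diophantine2"
proof -
  obtain \<kappa> :: real where \<kappa>: "\<kappa> > 0"
    and *: "\<And>p q :: int. q \<noteq> 0 \<Longrightarrow>
      \<bar>\<alpha> - real_of_int p / real_of_int q\<bar> > \<kappa> / \<bar>real_of_int q\<bar>\<^sup>2"
    using assms unfolding diophantine2_def by blast
  have "\<bar>\<alpha> + of_int m - real_of_int p / real_of_int q\<bar> > \<kappa> / \<bar>real_of_int q\<bar>\<^sup>2"
    if "q \<noteq> 0" for p q :: int
  proof -
    have "\<alpha> + of_int m - real_of_int p / real_of_int q
        = \<alpha> - real_of_int (p - m * q) / real_of_int q"
      using that by (simp add: field_simps)
    then show ?thesis
      using *[OF that, of "p - m * q"] by (simp only:)
  qed
  then show ?thesis
    using \<kappa> unfolding diophantine2_def by blast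
qed

end

theory Submission
  imports Defs
begin

text \<open>
  The \<open>j\<close>-th term of the infimum is, up to the factor \<open>cusp_coeff \<epsilon>\<close>, the length of the vector
  \<open>(2 s r, j)\<close> with \<open>s = \<bar>sin (\<pi> j \<alpha>)\<bar>\<close>, and \<open>s\<close> is comparable to the distance from \<open>j \<alpha>\<close> to the
  nearest integer. Hence \<open>\<alpha>\<close> has bounded type exactly when \<open>j s\<close> stays above a positive
  constant (lemma \<open>diophantine2_iff_sin\<close>).

  The upper bound \<open>O(sqrt r)\<close> holds for every \<open>\<alpha>\<close>: Dirichlet's theorem gives some \<open>j \<le> sqrt r\<close>,
  up to rounding, for which \<open>s\<close> is \<open>O(1 / sqrt r)\<close>, and then both coordinates of the vector are
  \<open>O(sqrt r)\<close> (lemma \<open>boundary_fun_le_sqrt\<close>). So only the lower bound depends on \<open>\<alpha>\<close>. The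
  arithmetic-geometric mean inequality bounds the squared length of the vector below by
  \<open>4 j s r\<close>, so a lower bound on \<open>j s\<close> gives one on the boundary function (lemma
  \<open>sqrt_le_boundary_fun\<close>). Equality in that inequality occurs at \<open>r = j / (2 s)\<close>, which is
  finite because \<open>\<alpha>\<close> is irrational, and evaluating an assumed lower bound of order \<open>sqrt r\<close> at
  this \<open>r\<close> gives back the lower bound on \<open>j s\<close> (lemma \<open>sin_ge_of_sqrt_le_boundary_fun\<close>).
\<close>

section \<open>The sine and the distance to the nearest integer\<close>

text \<open>Jordan's inequality: on \<open>[0, 1/2]\<close> the concave function \<open>sin (\<pi> x)\<close> lies above its chord.\<close>

lemma two_mult_abs_le_abs_sin_pi:
  fixes x :: real
  assumes "\<bar>x\<bar> \<le> 1/2"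
  shows "2 * \<bar>x\<bar> \<le> \<bar>sin (pi * x)\<bar>"
proof -
  have conc: "concave_on {0..1/2} (\<lambda>x. sin (pi * x))"
  proof (rule f''_le0_imp_concave)
    show "((\<lambda>x. sin (pi * x)) has_real_derivative pi * cos (pi * x)) (at x)" for x
      by (auto intro!: derivative_eq_intros)
    show "((\<lambda>x. pi * cos (pi * x)) has_real_derivative - pi * pi * sin (pi * x)) (at x)" for x
      by (auto intro!: derivative_eq_intros)
    show "- pi * pi * sin (pi * x) \<le> 0" if "x \<in> {0..1/2}" for x
    proof -
      have "pi * x \<le> pi * 1"
        using that by (intro mult_left_mono) auto
      then show ?thesis
        using that by (simp add: sin_ge_zero)
    qed
  qed simp
  have "2 * \<bar>x\<bar> \<le> sin (pi * \<bar>x\<bar>)"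
    using concave_onD_Icc'[OF conc, of "\<bar>x\<bar>"] assms by simp
  also have "\<dots> \<le> \<bar>sin (pi * x)\<bar>"
    by (cases "x \<ge> 0") auto
  finally show ?thesis .
qed

lemma abs_sin_pi_diff_int: "\<bar>sin (pi * (x - of_int m))\<bar> = \<bar>sin (pi * x)\<bar>"
  by (auto simp: right_diff_distrib sin_diff)

lemma abs_sin_pi_le: "\<bar>sin (pi * x)\<bar> \<le> pi * \<bar>x - of_int m\<bar>"
  using abs_sin_x_le_abs_x[of "pi * (x - of_int m)"]
  by (simp add: abs_sin_pi_diff_int abs_mult)

lemma two_mult_abs_round_le_abs_sin_pi: "2 * \<bar>x - of_int (round x)\<bar> \<le> \<bar>sin (pi * x)\<bar>"
  using two_mult_abs_le_abs_sin_pi[of "x - of_int (round x)"] of_int_round_abs_le[of x]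
  by (simp add: abs_sin_pi_diff_int abs_minus_commute)

text \<open>Among the fractions with denominator \<open>j\<close>, the one closest to \<open>\<alpha>\<close> has the numerator
  \<open>round (j * \<alpha>)\<close>, and its distance to \<open>\<alpha>\<close> is comparable to \<open>\<bar>sin (\<pi> j \<alpha>)\<bar> / j\<close>.\<close>

lemma diophantine2_iff_sin:
  "\<alpha> \<in> diophantine2 \<longleftrightarrow>
    (\<exists>\<kappa>>0. \<forall>j\<ge>1. \<kappa> / real j \<le> \<bar>sin (pi * (real j * \<alpha>))\<bar>)"
proof
  assume "\<alpha> \<in> diophantine2"
  then obtain \<kappa> where "\<kappa> > 0"
    and \<kappa>: "\<And>p q :: int. q \<noteq> 0 \<Longrightarrow>
      \<kappa> / \<bar>real_of_int q\<bar>\<^sup>2 < \<bar>\<alpha> - real_of_int p / real_of_int q\<bar>"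
    unfolding diophantine2_def by blast
  have "2 * \<kappa> / real j \<le> \<bar>sin (pi * (real j * \<alpha>))\<bar>" if "j \<ge> 1" for j
  proof -
    have "real j * \<alpha> - real_of_int (round (real j * \<alpha>))
        = real j * (\<alpha> - real_of_int (round (real j * \<alpha>)) / real_of_int (int j))"
      using that by (simp add: field_simps)
    then have eq: "real j * \<bar>\<alpha> - real_of_int (round (real j * \<alpha>)) / real_of_int (int j)\<bar>
        = \<bar>real j * \<alpha> - real_of_int (round (real j * \<alpha>))\<bar>"
      by (simp only: abs_mult abs_of_nat)
    have "\<kappa> / real j = real j * (\<kappa> / \<bar>real_of_int (int j)\<bar>\<^sup>2)"
      using that by (simp add: field_simps power2_eq_square)
    also have "\<dots> \<le> real j * \<bar>\<alpha> - real_of_int (round (real j * \<alpha>)) / real_of_int (int j)\<bar>"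
      using \<kappa>[of "int j" "round (real j * \<alpha>)"] that by (intro mult_left_mono) auto
    also note eq
    finally show ?thesis
      using two_mult_abs_round_le_abs_sin_pi[of "real j * \<alpha>"] by simp
  qed
  then show "\<exists>\<kappa>>0. \<forall>j\<ge>1. \<kappa> / real j \<le> \<bar>sin (pi * (real j * \<alpha>))\<bar>"
    using \<open>\<kappa> > 0\<close> by (intro exI[of _ "2 * \<kappa>"]) auto
next
  assume "\<exists>\<kappa>>0. \<forall>j\<ge>1. \<kappa> / real j \<le> \<bar>sin (pi * (real j * \<alpha>))\<bar>"
  then obtain \<kappa> where "\<kappa> > 0"
    and \<kappa>: "\<And>j::nat. j \<ge> 1 \<Longrightarrow> \<kappa> / real j \<le> \<bar>sin (pi * (real j * \<alpha>))\<bar>"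
    by blast
  have "\<kappa> / (2 * pi) / \<bar>real_of_int q\<bar>\<^sup>2 < \<bar>\<alpha> - real_of_int p / real_of_int q\<bar>"
    if "q \<noteq> 0" for p q :: int
  proof -
    define j where "j = nat \<bar>q\<bar>"
    have j: "j \<ge> 1" "real j = \<bar>real_of_int q\<bar>"
      using that by (auto simp: j_def)
    have "real j * \<alpha> - of_int (sgn q * p) = real j * (\<alpha> - real_of_int p / real_of_int q)"
      using that unfolding j(2) by (cases "q > 0") (auto simp: field_simps)
    then have eq: "\<bar>real j * \<alpha> - of_int (sgn q * p)\<bar>
        = real j * \<bar>\<alpha> - real_of_int p / real_of_int q\<bar>"
      by (simp only: abs_mult abs_of_nat)
    have "\<kappa> / real j \<le> pi * (real j * \<bar>\<alpha> - real_of_int p / real_of_int q\<bar>)"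
      using \<kappa>[OF j(1)] abs_sin_pi_le[of "real j * \<alpha>" "sgn q * p"] unfolding eq by linarith
    then have "\<kappa> / (pi * (real j)\<^sup>2) \<le> \<bar>\<alpha> - real_of_int p / real_of_int q\<bar>"
      using j(1) by (simp add: field_simps power2_eq_square)
    moreover have "\<kappa> / (2 * pi) / (real j)\<^sup>2 < \<kappa> / (pi * (real j)\<^sup>2)"
      using j(1) \<open>\<kappa> > 0\<close> by (simp add: field_simps)
    ultimately show ?thesis
      unfolding j(2) by linarith
  qed
  then show "\<alpha> \<in> diophantine2"
    using \<open>\<kappa> > 0\<close> unfolding diophantine2_def
    by (intro CollectI exI[of _ "\<kappa> / (2 * pi)"]) auto
qed

section \<open>Bounds for the boundary function\<close>

lemma cusp_coeff_pos:
  assumes "0 < \<epsilon>"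
  shows "0 < cusp_coeff \<epsilon>"
proof -
  have "cosh 0 < cosh \<epsilon>"
    using assms by (subst cosh_real_nonneg_less_iff) auto
  then show ?thesis
    by (simp add: cusp_coeff_def)
qed

lemma boundary_fun_le:
  assumes "0 < \<epsilon>" "j \<ge> 1"
  shows "boundary_fun \<epsilon> \<alpha> r
    \<le> cusp_coeff \<epsilon> * sqrt (4 * (sin (pi * (real j * \<alpha>)))\<^sup>2 * r\<^sup>2 + (real j)\<^sup>2)"
  unfolding boundary_fun_def mult.assoc[of pi] using assms cusp_coeff_pos[OF assms(1)]
  by (intro cINF_lower bdd_belowI2[where m = 0]) auto

text \<open>The number \<open>N\<close> below balances the two summands in the bound that Dirichlet's theorem gives.\<close>

lemma boundary_fun_le_sqrt:
  assumes "0 < \<epsilon>" "1 \<le> r"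
  shows "boundary_fun \<epsilon> \<alpha> r \<le> cusp_coeff \<epsilon> * sqrt (4 * pi\<^sup>2 + 4) * sqrt r"
proof -
  define N where "N = nat \<lceil>sqrt r\<rceil>"
  have N: "sqrt r \<le> real N" "real N \<le> 2 * sqrt r" "N > 0"
    using assms(2) real_sqrt_ge_one[of r] unfolding N_def by linarith+
  obtain h k where k: "0 < k" "k \<le> int N" and hk: "\<bar>of_int k * \<alpha> - of_int h\<bar> < 1 / real N"
    using Dirichlet_approx[OF N(3)] by metis
  define j where "j = nat k"
  have j: "j \<ge> 1" "real_of_int k = real j" "real j \<le> real N"
    using k by (auto simp: j_def)
  have "\<bar>sin (pi * (real j * \<alpha>))\<bar> \<le> pi * \<bar>real j * \<alpha> - of_int h\<bar>"
    by (rule abs_sin_pi_le)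
  also have "\<dots> \<le> pi * (1 / sqrt r)"
  proof (intro mult_left_mono)
    have "1 / real N \<le> 1 / sqrt r"
      using N assms(2) by (intro divide_left_mono) auto
    then show "\<bar>real j * \<alpha> - of_int h\<bar> \<le> 1 / sqrt r"
      using hk j(2) by simp
  qed simp
  finally have "(sin (pi * (real j * \<alpha>)))\<^sup>2 \<le> (pi * (1 / sqrt r))\<^sup>2"
    using abs_le_square_iff assms(2) by fastforce
  also have "\<dots> = pi\<^sup>2 / r"
    using assms(2) by (simp add: power_mult_distrib power_divide)
  finally have "4 * (sin (pi * (real j * \<alpha>)))\<^sup>2 * r\<^sup>2 \<le> 4 * (pi\<^sup>2 / r) * r\<^sup>2"
    by (intro mult_right_mono) auto
  also have "\<dots> = 4 * pi\<^sup>2 * r"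
    using assms(2) by (simp add: power2_eq_square)
  finally have 1: "4 * (sin (pi * (real j * \<alpha>)))\<^sup>2 * r\<^sup>2 \<le> 4 * pi\<^sup>2 * r" .
  have "(real j)\<^sup>2 \<le> (2 * sqrt r)\<^sup>2"
    using j N by (intro power_mono) auto
  then have 2: "(real j)\<^sup>2 \<le> 4 * r"
    using assms(2) by (simp add: power_mult_distrib)
  have "boundary_fun \<epsilon> \<alpha> r
      \<le> cusp_coeff \<epsilon> * sqrt (4 * (sin (pi * (real j * \<alpha>)))\<^sup>2 * r\<^sup>2 + (real j)\<^sup>2)"
    using boundary_fun_le assms(1) j(1) .
  also have "\<dots> \<le> cusp_coeff \<epsilon> * sqrt ((4 * pi\<^sup>2 + 4) * r)"
    using 1 2 cusp_coeff_pos[OF assms(1)]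
    by (intro mult_left_mono real_sqrt_le_mono) (auto simp: distrib_right)
  finally show ?thesis
    by (simp add: real_sqrt_mult)
qed

lemma sqrt_le_boundary_fun:
  assumes "0 < \<epsilon>" "0 \<le> \<kappa>" "0 \<le> r"
    and sin_ge: "\<And>j::nat. j \<ge> 1 \<Longrightarrow> \<kappa> / real j \<le> \<bar>sin (pi * (real j * \<alpha>))\<bar>"
  shows "cusp_coeff \<epsilon> * sqrt (4 * \<kappa>) * sqrt r \<le> boundary_fun \<epsilon> \<alpha> r"
proof -
  have "cusp_coeff \<epsilon> * sqrt (4 * \<kappa> * r)
      \<le> cusp_coeff \<epsilon> * sqrt (4 * (sin (pi * (real j * \<alpha>)))\<^sup>2 * r\<^sup>2 + (real j)\<^sup>2)"
    if "j \<ge> 1" for j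
  proof (intro mult_left_mono real_sqrt_le_mono)
    let ?s = "\<bar>sin (pi * (real j * \<alpha>))\<bar>"
    have "\<kappa> \<le> ?s * real j"
      using sin_ge[OF that] that by (simp add: field_simps)
    then have "4 * \<kappa> * r \<le> 4 * (?s * real j) * r"
      using assms(3) by (intro mult_right_mono mult_left_mono) auto
    also have "\<dots> \<le> (2 * ?s * r)\<^sup>2 + (real j)\<^sup>2"
      using sum_squares_bound[of "2 * ?s * r" "real j"] by (simp add: algebra_simps)
    also have "\<dots> = 4 * (sin (pi * (real j * \<alpha>)))\<^sup>2 * r\<^sup>2 + (real j)\<^sup>2"
      by (simp add: power_mult_distrib)
    finally show "4 * \<kappa> * r \<le> 4 * (sin (pi * (real j * \<alpha>)))\<^sup>2 * r\<^sup>2 + (real j)\<^sup>2" .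
  qed (use cusp_coeff_pos[OF assms(1)] in simp)
  then have "cusp_coeff \<epsilon> * sqrt (4 * \<kappa> * r) \<le> boundary_fun \<epsilon> \<alpha> r"
    unfolding boundary_fun_def mult.assoc[of pi] by (intro cINF_greatest) auto
  then show ?thesis
    by (simp add: real_sqrt_mult mult.assoc)
qed

text \<open>The radius \<open>j / (2 s)\<close> makes both summands of the \<open>j\<close>-th term equal. It need not lie beyond
  the threshold \<open>R\<close>, but if it does not, then \<open>s\<close> is bounded below by \<open>j / (2 R)\<close>, which is even
  more than needed.\<close>

lemma sin_ge_of_sqrt_le_boundary_fun:
  assumes "0 < \<epsilon>" "0 < c" "0 < R" "\<alpha> \<notin> \<rat>"
    and sqrt_le: "\<And>r. R \<le> r \<Longrightarrow> c * sqrt r \<le> boundary_fun \<epsilon> \<alpha> r"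
    and "j \<ge> 1"
  shows "min (c\<^sup>2 / (4 * (cusp_coeff \<epsilon>)\<^sup>2)) (1 / (2 * R)) / real j
    \<le> \<bar>sin (pi * (real j * \<alpha>))\<bar>"
proof -
  define s where "s = \<bar>sin (pi * (real j * \<alpha>))\<bar>"
  define r where "r = real j / (2 * s)"
  have "real j * \<alpha> \<notin> \<int>"
  proof
    assume "real j * \<alpha> \<in> \<int>"
    then have "real j * \<alpha> / real j \<in> \<rat>"
      using Ints_subset_Rats by (intro Rats_divide) auto
    then show False
      using assms(4,6) by simp
  qed
  then have "s > 0"
    using sin_times_pi_eq_0[of "real j * \<alpha>"] by (simp add: s_def mult.commute)
  show ?thesis
  proof (cases "R \<le> r")
    case True
    have "r \<ge> 0"
      using \<open>s > 0\<close> by (simp add: r_def)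
    have balance: "4 * (sin (pi * (real j * \<alpha>)))\<^sup>2 * r\<^sup>2 = (real j)\<^sup>2"
      using \<open>s > 0\<close> unfolding r_def s_def by (simp add: power_divide power_mult_distrib)
    have "c * sqrt r \<le> cusp_coeff \<epsilon> * sqrt ((real j)\<^sup>2 + (real j)\<^sup>2)"
      using sqrt_le[OF True] boundary_fun_le[OF assms(1,6), of \<alpha> r] unfolding balance
      by linarith
    then have "(c * sqrt r)\<^sup>2 \<le> (cusp_coeff \<epsilon> * sqrt ((real j)\<^sup>2 + (real j)\<^sup>2))\<^sup>2"
      using assms(2) \<open>r \<ge> 0\<close> by (intro power_mono) auto
    then have "c\<^sup>2 * (real j / (2 * s)) \<le> (cusp_coeff \<epsilon>)\<^sup>2 * (2 * (real j)\<^sup>2)"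
      using \<open>r \<ge> 0\<close> by (simp add: power_mult_distrib r_def)
    then have "c\<^sup>2 / (4 * (cusp_coeff \<epsilon>)\<^sup>2) / real j \<le> s"
      using \<open>s > 0\<close> assms(6) cusp_coeff_pos[OF assms(1)]
      by (simp add: field_simps power2_eq_square)
    moreover have "min (c\<^sup>2 / (4 * (cusp_coeff \<epsilon>)\<^sup>2)) (1 / (2 * R)) / real j
        \<le> c\<^sup>2 / (4 * (cusp_coeff \<epsilon>)\<^sup>2) / real j"
      by (intro divide_right_mono) auto
    ultimately show ?thesis
      by (simp add: s_def)
  next
    case False
    have "min (c\<^sup>2 / (4 * (cusp_coeff \<epsilon>)\<^sup>2)) (1 / (2 * R)) / real j \<le> 1 / (2 * R) / real j"
      by (intro divide_right_mono) auto
    also have "\<dots> \<le> 1 / (2 * R) * real j"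
      using assms(3,6) mult_mono[of 1 "real j" 1 "real j"] by (simp add: field_simps)
    also have "\<dots> \<le> s"
      using False \<open>s > 0\<close> assms(3) by (simp add: r_def field_simps)
    finally show ?thesis
      by (simp add: s_def)
  qed
qed

section \<open>Growth of order \<open>sqrt r\<close> characterizes bounded type\<close>

theorem theorem4p7:
  fixes \<epsilon> \<alpha> :: real
  assumes "0 < \<epsilon>" and "\<epsilon> \<le> margulis_constant"
    and "\<alpha> \<notin> \<rat>"
  shows "comparable_at_top (boundary_fun \<epsilon> \<alpha>) (\<lambda>r. sqrt r) \<longleftrightarrow> \<alpha> \<in> diophantine2"
proof
  assume "comparable_at_top (boundary_fun \<epsilon> \<alpha>) (\<lambda>r. sqrt r)"
  then obtain C R0 where "C \<ge> 1"
    and R0: "\<And>r. R0 \<le> r \<Longrightarrow> inverse C * sqrt r \<le> boundary_fun \<epsilon> \<alpha> r"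
    unfolding comparable_at_top_def eventually_at_top_linorder by blast
  define \<kappa> where
    "\<kappa> = min ((inverse C)\<^sup>2 / (4 * (cusp_coeff \<epsilon>)\<^sup>2)) (1 / (2 * max R0 1))"
  have "\<kappa> > 0"
    using \<open>C \<ge> 1\<close> cusp_coeff_pos[OF assms(1)] by (simp add: \<kappa>_def)
  moreover have "\<kappa> / real j \<le> \<bar>sin (pi * (real j * \<alpha>))\<bar>" if "j \<ge> 1" for j
    unfolding \<kappa>_def using \<open>C \<ge> 1\<close>
    by (intro sin_ge_of_sqrt_le_boundary_fun[OF assms(1) _ _ assms(3) R0 that]) auto
  ultimately show "\<alpha> \<in> diophantine2"
    unfolding diophantine2_iff_sin by blast
next
  assume "\<alpha> \<in> diophantine2"
  then obtain \<kappa> where "\<kappa> > 0"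
    and \<kappa>: "\<And>j::nat. j \<ge> 1 \<Longrightarrow> \<kappa> / real j \<le> \<bar>sin (pi * (real j * \<alpha>))\<bar>"
    unfolding diophantine2_iff_sin by blast
  define a where "a = cusp_coeff \<epsilon> * sqrt (4 * \<kappa>)"
  define b where "b = cusp_coeff \<epsilon> * sqrt (4 * pi\<^sup>2 + 4)"
  define C where "C = max 1 (max (inverse a) b)"
  have "a > 0"
    using \<open>\<kappa> > 0\<close> cusp_coeff_pos[OF assms(1)] by (simp add: a_def)
  have C: "C \<ge> 1" "inverse C \<le> a" "b \<le> C"
    using \<open>a > 0\<close> le_imp_inverse_le[of "inverse a" C] by (auto simp: C_def)
  have "inverse C * sqrt r \<le> boundary_fun \<epsilon> \<alpha> r \<and> boundary_fun \<epsilon> \<alpha> r \<le> C * sqrt r"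
    if "r \<ge> 1" for r
  proof
    have "inverse C * sqrt r \<le> a * sqrt r"
      using C that by (intro mult_right_mono) auto
    also have "\<dots> \<le> boundary_fun \<epsilon> \<alpha> r"
      unfolding a_def using assms(1) \<open>\<kappa> > 0\<close> \<kappa> that by (intro sqrt_le_boundary_fun) auto
    finally show "inverse C * sqrt r \<le> boundary_fun \<epsilon> \<alpha> r" .
    have "boundary_fun \<epsilon> \<alpha> r \<le> b * sqrt r"
      unfolding b_def using assms(1) that by (rule boundary_fun_le_sqrt)
    also have "\<dots> \<le> C * sqrt r"
      using C that by (intro mult_right_mono) auto
    finally show "boundary_fun \<epsilon> \<alpha> r \<le> C * sqrt r" .
  qed
  then show "comparable_at_top (boundary_fun \<epsilon> \<alpha>) (\<lambda>r. sqrt r)"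
    unfolding comparable_at_top_def eventually_at_top_linorder using C(1) by blast
qed

end
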